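(* Let $\theta$ be a totally ordered set, let $(S_\alpha)_{\alpha\in\theta}$ be a family of distributive lattices, and let $f_{\alpha,\beta}\colon S_\alpha\to S_\beta$ (for $\alpha\le\beta$ in $\theta$) be join-homomorphisms forming a direct system. Let $S=\varinjlim_{\alpha\in\theta}S_\alpha$ be the direct limit of this system in the category of join-semilattices and join-homomorphisms. Then $S$ satisfies $\mathrm{URP}^+$.
   Context: The transition maps $f_{\alpha,\beta}$ are only required to preserve binary joins (not meets), with $f_{\alpha,\alpha}=\mathrm{id}$ and $f_{\beta,\gamma}\circ f_{\alpha,\beta}=f_{\alpha,\gamma}$ for $\alpha\le\beta\le\gamma$. Such a limit is called a $\vee$-direct limit. Let $S$ be a join-semilattice and let $e\in S$. We say that $S$ satisfies $\mathrm{URP}^+$ at $e$ if for every set $I$ and all families $\langle a_i\mid i\in I\rangle$ and $\langle b_i\mid i\in I\rangle$ of elements of $S$ such that $a_i\vee b_i=e$ for all $i\in I$, there are elements $c_{i,j}\in S$ (for $i,j\in I$) such that: (i) $c_{i,j}\le a_i$ and $c_{i,j}\le b_j$, for all $i,j\in I$; (ii) $a_i\le a_j\vee c_{i,j}$ and $b_j\le b_i\vee c_{i,j}$, for all $i,j\in I$; (iii) $c_{i,k}\le c_{i,j}\vee c_{j,k}$, for all $i,j,k\in I$. We say that $S$ satisfies (or has) $\mathrm{URP}^+$ if it satisfies $\mathrm{URP}^+$ at each of its elements. *)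

theory Defs
  imports "HOL-Algebra.Lattice" "HOL-Library.FuncSet"
begin

text \<open>
  Join-semilattices are the partial orders with carrier of the locale \<open>upper_semilattice\<close>;
  least and greatest elements are neither required nor preserved.
\<close>

locale distributive_lattice = lattice +
  assumes meet_join_distrib:
    "\<lbrakk>x \<in> carrier L; y \<in> carrier L; z \<in> carrier L\<rbrakk>
      \<Longrightarrow> x \<sqinter> (y \<squnion> z) = (x \<sqinter> y) \<squnion> (x \<sqinter> z)"

(* The library's join_pres is not used because it demands that both sides be lattices. *)
definition join_hom :: "'a gorder \<Rightarrow> 'b gorder \<Rightarrow> ('a \<Rightarrow> 'b) set" where
  "join_hom L M = {h \<in> carrier L \<rightarrow> carrier M.
     \<forall>x\<in>carrier L. \<forall>y\<in>carrier L. h (x \<squnion>\<^bsub>L\<^esub> y) = h x \<squnion>\<^bsub>M\<^esub> h y}"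

definition join_direct_system ::
  "('i::order \<Rightarrow> 'a gorder) \<Rightarrow> ('i \<Rightarrow> 'i \<Rightarrow> 'a \<Rightarrow> 'a) \<Rightarrow> bool" where
  "join_direct_system S f \<longleftrightarrow>
     (\<forall>\<alpha>. upper_semilattice (S \<alpha>)) \<and>
     (\<forall>\<alpha> \<beta>. \<alpha> \<le> \<beta> \<longrightarrow> f \<alpha> \<beta> \<in> join_hom (S \<alpha>) (S \<beta>)) \<and>
     (\<forall>\<alpha>. \<forall>x\<in>carrier (S \<alpha>). f \<alpha> \<alpha> x = x) \<and>
     (\<forall>\<alpha> \<beta> \<gamma>. \<alpha> \<le> \<beta> \<longrightarrow> \<beta> \<le> \<gamma> \<longrightarrow>
        (\<forall>x\<in>carrier (S \<alpha>). f \<beta> \<gamma> (f \<alpha> \<beta> x) = f \<alpha> \<gamma> x))"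

definition join_cocone ::
  "('i::order \<Rightarrow> 'a gorder) \<Rightarrow> ('i \<Rightarrow> 'i \<Rightarrow> 'a \<Rightarrow> 'a) \<Rightarrow> 't gorder \<Rightarrow> ('i \<Rightarrow> 'a \<Rightarrow> 't) \<Rightarrow> bool" where
  "join_cocone S f T g \<longleftrightarrow>
     upper_semilattice T \<and>
     (\<forall>\<alpha>. g \<alpha> \<in> join_hom (S \<alpha>) T) \<and>
     (\<forall>\<alpha> \<beta>. \<alpha> \<le> \<beta> \<longrightarrow> (\<forall>x\<in>carrier (S \<alpha>). g \<beta> (f \<alpha> \<beta> x) = g \<alpha> x))"

text \<open>
  The universal property of the direct limit \<open>L\<close> with limiting maps \<open>\<phi>\<close> in the category of
  join-semilattices and join-homomorphisms.  HOL cannot quantify over types inside a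
  definition, so the type \<open>'t\<close> over which the test objects \<open>T\<close> live is a parameter: a direct
  limit has this property for every \<open>'t\<close>.  Conversely, over a directed order, the property for
  \<open>'t = ('i \<times> 'a) set\<close> determines \<open>L\<close> up to isomorphism, because this type carries the usual
  construction of the limit (as a quotient of the disjoint union of the \<open>S \<alpha>\<close>) as well as
  the two-element semilattice.  Mediating maps are taken \<^term>\<open>extensional\<close> because
  uniqueness can only concern their values on the carrier.
\<close>

definition join_direct_limit ::
  "'t itself \<Rightarrow> ('i::order \<Rightarrow> 'a gorder) \<Rightarrow> ('i \<Rightarrow> 'i \<Rightarrow> 'a \<Rightarrow> 'a)
     \<Rightarrow> 's gorder \<Rightarrow> ('i \<Rightarrow> 'a \<Rightarrow> 's) \<Rightarrow> bool" where
  "join_direct_limit _ S f L \<phi> \<longleftrightarrow>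
     join_cocone S f L \<phi> \<and>
     (\<forall>(T :: 't gorder) g. join_cocone S f T g \<longrightarrow>
        (\<exists>!h. h \<in> join_hom L T \<and> h \<in> extensional (carrier L) \<and>
              (\<forall>\<alpha>. \<forall>x\<in>carrier (S \<alpha>). h (\<phi> \<alpha> x) = g \<alpha> x)))"

text \<open>
  ``For every set \<open>I\<close>'' is rendered as every set \<open>I\<close> over an index type \<open>'k\<close>, which again is a
  parameter; a theorem that leaves \<open>'k\<close> free covers all index sets.
\<close>

definition URP_plus_at :: "'k itself \<Rightarrow> 's gorder \<Rightarrow> 's \<Rightarrow> bool" where
  "URP_plus_at _ L e \<longleftrightarrow>
     (\<forall>(I :: 'k set) a b.
        (\<forall>i\<in>I. a i \<in> carrier L \<and> b i \<in> carrier L \<and> a i \<squnion>\<^bsub>L\<^esub> b i = e) \<longrightarrow>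
        (\<exists>c. (\<forall>i\<in>I. \<forall>j\<in>I. c i j \<in> carrier L) \<and>
             (\<forall>i\<in>I. \<forall>j\<in>I. c i j \<sqsubseteq>\<^bsub>L\<^esub> a i \<and> c i j \<sqsubseteq>\<^bsub>L\<^esub> b j) \<and>
             (\<forall>i\<in>I. \<forall>j\<in>I. a i \<sqsubseteq>\<^bsub>L\<^esub> a j \<squnion>\<^bsub>L\<^esub> c i j \<and> b j \<sqsubseteq>\<^bsub>L\<^esub> b i \<squnion>\<^bsub>L\<^esub> c i j) \<and>
             (\<forall>i\<in>I. \<forall>j\<in>I. \<forall>k\<in>I. c i k \<sqsubseteq>\<^bsub>L\<^esub> c i j \<squnion>\<^bsub>L\<^esub> c j k)))"

definition URP_plus :: "'k itself \<Rightarrow> 's gorder \<Rightarrow> bool" where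
  "URP_plus K L \<longleftrightarrow> (\<forall>e\<in>carrier L. URP_plus_at K L e)"

end

theory Submission
  imports Defs
begin

text \<open>
  Homomorphisms into the two-element semilattice suffice to see that every element of the
  limit comes from some \<open>S \<alpha>\<close>, and that an inequality in the limit already holds at a
  later stage.  Hence for each index \<open>i\<close> there is a stage \<open>\<nu> i\<close> at which \<open>a\<^sub>i\<close> and \<open>b\<^sub>i\<close>
  have representatives whose join represents \<open>e\<close>.  Let \<open>c\<^sub>i\<^sub>j\<close> be the image of the meet of
  the representatives of \<open>a\<^sub>i\<close> and \<open>b\<^sub>j\<close> at stage \<open>max (\<nu> i) (\<nu> j)\<close>.  Transition maps need not
  preserve meets, but in \<open>c\<^sub>i\<^sub>k \<le> c\<^sub>i\<^sub>j \<or> c\<^sub>j\<^sub>k\<close> at least two of the three meets are formed at the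
  largest of the three stages, and the images of inequalities from the remaining stage suffice.
\<close>

section \<open>Distributive lattices and join-homomorphisms\<close>

context upper_semilattice
begin

lemma le_iff_join_eq:
  assumes "x \<in> carrier L" "y \<in> carrier L"
  shows "x \<sqsubseteq> y \<longleftrightarrow> x \<squnion> y = y"
proof
  assume "x \<sqsubseteq> y"
  then show "x \<squnion> y = y"
    using assms by (intro le_antisym) (auto simp: join_le join_right)
next
  assume "x \<squnion> y = y"
  then show "x \<sqsubseteq> y" using join_left[OF assms] by simp
qed

lemma join_le_iff:
  assumes "x \<in> carrier L" "y \<in> carrier L" "z \<in> carrier L"
  shows "x \<squnion> y \<sqsubseteq> z \<longleftrightarrow> x \<sqsubseteq> z \<and> y \<sqsubseteq> z"
proof
  assume "x \<squnion> y \<sqsubseteq> z"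
  then show "x \<sqsubseteq> z \<and> y \<sqsubseteq> z"
    using assms le_trans[OF join_left[of x y]] le_trans[OF join_right[of x y]] by simp
next
  assume "x \<sqsubseteq> z \<and> y \<sqsubseteq> z"
  then show "x \<squnion> y \<sqsubseteq> z" using assms by (simp add: join_le)
qed

lemma join_mono:
  assumes "x \<in> carrier L" "y \<in> carrier L" "z \<in> carrier L" "w \<in> carrier L" "x \<sqsubseteq> z" "y \<sqsubseteq> w"
  shows "x \<squnion> y \<sqsubseteq> z \<squnion> w"
  using assms le_trans[OF assms(5) join_left[of z w]] le_trans[OF assms(6) join_right[of z w]]
  by (simp add: join_le)

end

context distributive_lattice
begin

text \<open>After distributing \<open>w\<close> over the join, the summand
  \<open>w \<sqinter> z\<close> is weakened to \<open>z\<close>. Since \<open>z\<close> is left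
  intact, it may be the image of a meet formed at an earlier stage, about which only inequalities
  are known.\<close>

lemma meet_join_le:
  assumes "x \<in> carrier L" "y \<in> carrier L" "z \<in> carrier L" "w \<in> carrier L" "x \<sqsubseteq> y \<squnion> z"
  shows "w \<sqinter> x \<sqsubseteq> (w \<sqinter> y) \<squnion> z"
proof -
  have "w \<sqinter> x \<sqsubseteq> y \<squnion> z"
    using le_trans[OF meet_right[of w x] assms(5)] assms by simp
  then have "w \<sqinter> x \<sqsubseteq> w \<sqinter> (y \<squnion> z)"
    using assms by (simp add: meet_le meet_left)
  also have "w \<sqinter> (y \<squnion> z) = (w \<sqinter> y) \<squnion> (w \<sqinter> z)"
    using assms by (simp add: meet_join_distrib)
  also have "\<dots> \<sqsubseteq> (w \<sqinter> y) \<squnion> z"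
    using assms by (intro join_mono) (auto simp: meet_right)
  finally show ?thesis using assms by simp
qed

text \<open>This yields condition (ii) at a stage: for \<open>x\<close>, \<open>y\<close>,
  \<open>z\<close> representing a_i, a_j, b_j, the hypothesis is a_i \<le> e = a_j \<or> b_j, and
  \<open>x \<sqinter> z\<close> is the candidate for c_ij.\<close>

lemma le_join_meet:
  assumes "x \<in> carrier L" "y \<in> carrier L" "z \<in> carrier L" "x \<sqsubseteq> y \<squnion> z"
  shows "x \<sqsubseteq> y \<squnion> (x \<sqinter> z)"
proof -
  have "x \<sqsubseteq> x \<sqinter> (z \<squnion> y)"
    using assms by (simp add: meet_le join_comm[of L z y])
  also have "x \<sqinter> (z \<squnion> y) \<sqsubseteq> (x \<sqinter> z) \<squnion> y"
    using assms by (intro meet_join_le) auto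
  finally show ?thesis using assms by (simp add: join_comm[of L y])
qed

end

lemma join_hom_closed: "h \<in> join_hom L M \<Longrightarrow> x \<in> carrier L \<Longrightarrow> h x \<in> carrier M"
  by (auto simp: join_hom_def)

lemma join_hom_join:
  "h \<in> join_hom L M \<Longrightarrow> x \<in> carrier L \<Longrightarrow> y \<in> carrier L
    \<Longrightarrow> h (x \<squnion>\<^bsub>L\<^esub> y) = h x \<squnion>\<^bsub>M\<^esub> h y"
  by (auto simp: join_hom_def)

lemma join_hom_mono:
  assumes "upper_semilattice L" "upper_semilattice M" "h \<in> join_hom L M"
    and "x \<in> carrier L" "y \<in> carrier L" "x \<sqsubseteq>\<^bsub>L\<^esub> y"
  shows "h x \<sqsubseteq>\<^bsub>M\<^esub> h y"
proof -
  interpret L: upper_semilattice L by fact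
  interpret M: upper_semilattice M by fact
  have "h x \<squnion>\<^bsub>M\<^esub> h y = h y"
    using assms by (simp flip: join_hom_join add: L.le_iff_join_eq)
  then show ?thesis using assms by (simp add: M.le_iff_join_eq join_hom_closed)
qed

section \<open>The two-element semilattice\<close>

text \<open>The two elements are sets over \<open>'t\<close>, so that a universal property for test
  objects over \<open>'t set\<close> applies to this semilattice. They are distinct because types
  are nonempty.\<close>

definition two :: "'t set gorder" where
  "two = \<lparr>carrier = {{}, UNIV}, eq = (=), le = (\<subseteq>)\<rparr>"

lemma two_simps [simp]:
  "carrier two = {{}, UNIV}" "x \<sqsubseteq>\<^bsub>two\<^esub> y \<longleftrightarrow> x \<subseteq> y" "x .=\<^bsub>two\<^esub> y \<longleftrightarrow> x = y"
  by (auto simp: two_def)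

lemma upper_semilattice_two: "upper_semilattice (two :: 't set gorder)"
proof
  fix x y :: "'t set" assume "x \<in> carrier two" "y \<in> carrier two"
  then have "least two (x \<union> y) (Upper two {x, y})"
    by (auto simp: least_def Upper_def)
  then show "\<exists>s. least two s (Upper two {x, y})" ..
qed (auto simp: fun_eq_iff)

lemma join_two:
  assumes "x \<in> carrier two" "y \<in> carrier two"
  shows "x \<squnion>\<^bsub>two\<^esub> y = x \<union> y"
proof -
  interpret two: upper_semilattice two by (rule upper_semilattice_two)
  have "x \<union> y \<in> carrier two" using assms by auto
  then show ?thesis
    using assms two.join_le[of x "x \<union> y" y] two.join_left[of x y] two.join_right[of x y] by auto
qed

definition ideal_char :: "'a set \<Rightarrow> 'a \<Rightarrow> 't set" where
  "ideal_char D x = (if x \<in> D then {} else UNIV)"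

text \<open>The condition says that \<open>D\<close> is an ideal, possibly empty: one direction
  makes it a lower set, the other closes it under joins. The ideal becomes the fibre over the least
  element of \<open>two\<close>.\<close>

lemma ideal_char_join_hom:
  assumes "\<And>x y. x \<in> carrier L \<Longrightarrow> y \<in> carrier L \<Longrightarrow> x \<squnion>\<^bsub>L\<^esub> y \<in> D \<longleftrightarrow> x \<in> D \<and> y \<in> D"
  shows "ideal_char D \<in> join_hom L two"
  using assms by (auto simp: join_hom_def join_two ideal_char_def)

text \<open>Mediating maps are required to be extensional, so a candidate has to be cut off outside
  the carrier.\<close>

lemma restrict_join_hom:
  assumes "upper_semilattice L" "h \<in> join_hom L M"
  shows "restrict h (carrier L) \<in> join_hom L M"
proof -
  interpret upper_semilattice L by fact
  show ?thesis using assms(2) by (auto simp: join_hom_def)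
qed

section \<open>Linear direct limits\<close>

text \<open>This rests on the uniqueness of mediating maps: if \<open>p\<close> were missed by every
  \<open>\<phi> \<alpha>\<close>, two maps from \<open>L\<close> to \<open>two\<close> that differ
  at \<open>p\<close> would induce the same cocone.\<close>

lemma join_limit_jointly_surjective:
  fixes S :: "'i::linorder \<Rightarrow> 'a gorder"
  assumes system: "join_direct_system S f"
    and limit: "join_direct_limit TYPE('t set) S f L \<phi>"
    and p: "p \<in> carrier L"
  shows "\<exists>\<alpha>. \<exists>x\<in>carrier (S \<alpha>). p = \<phi> \<alpha> x"
proof (rule ccontr)
  assume not_image: "\<not> ?thesis"
  have cocone: "join_cocone S f L \<phi>" using limit by (simp add: join_direct_limit_def)
  have hom: "\<phi> \<alpha> \<in> join_hom (S \<alpha>) L" for \<alpha> using cocone by (simp add: join_cocone_def)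
  interpret L: upper_semilattice L using cocone by (simp add: join_cocone_def)
  interpret S: upper_semilattice "S \<xi>" for \<xi> using system by (simp add: join_direct_system_def)
  have f_hom: "f \<alpha> \<beta> \<in> join_hom (S \<alpha>) (S \<beta>)" if "\<alpha> \<le> \<beta>" for \<alpha> \<beta>
    using system that by (simp add: join_direct_system_def)
  have f_\<phi>: "\<phi> \<beta> (f \<alpha> \<beta> x) = \<phi> \<alpha> x" if "\<alpha> \<le> \<beta>" "x \<in> carrier (S \<alpha>)" for \<alpha> \<beta> x
    using cocone that by (simp add: join_cocone_def)
  define R where "R = (\<Union>\<alpha>. \<phi> \<alpha> ` carrier (S \<alpha>))"
  have R_closed: "R \<subseteq> carrier L" using hom by (auto simp: R_def dest: join_hom_closed)
  \<comment> \<open>Linearity of the index order lets both elements be represented at one stage.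
    Closure of the image under joins makes \<open>E\<close> below an ideal.\<close>
  have R_join: "r \<squnion>\<^bsub>L\<^esub> s \<in> R" if rs: "r \<in> R" "s \<in> R" for r s
  proof -
    obtain \<alpha> x \<beta> y where xy: "x \<in> carrier (S \<alpha>)" "r = \<phi> \<alpha> x" "y \<in> carrier (S \<beta>)" "s = \<phi> \<beta> y"
      using rs unfolding R_def by blast
    let ?\<gamma> = "max \<alpha> \<beta>"
    have c: "f \<alpha> ?\<gamma> x \<in> carrier (S ?\<gamma>)" "f \<beta> ?\<gamma> y \<in> carrier (S ?\<gamma>)"
      using xy by (auto intro: join_hom_closed[OF f_hom])
    have "r \<squnion>\<^bsub>L\<^esub> s = \<phi> ?\<gamma> (f \<alpha> ?\<gamma> x) \<squnion>\<^bsub>L\<^esub> \<phi> ?\<gamma> (f \<beta> ?\<gamma> y)"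
      using xy by (simp add: f_\<phi>)
    also have "\<dots> = \<phi> ?\<gamma> (f \<alpha> ?\<gamma> x \<squnion>\<^bsub>S ?\<gamma>\<^esub> f \<beta> ?\<gamma> y)"
      using c by (simp add: join_hom_join[OF hom])
    finally show ?thesis using S.join_closed[OF c] unfolding R_def by blast
  qed
  \<comment> \<open>Two ideals of \<open>L\<close> with the same trace on the image, only the first of which contains \<open>p\<close>.\<close>
  define D where "D = {x \<in> carrier L. x \<sqsubseteq>\<^bsub>L\<^esub> p}"
  define E where "E = {x \<in> carrier L. \<exists>r\<in>R. r \<sqsubseteq>\<^bsub>L\<^esub> p \<and> x \<sqsubseteq>\<^bsub>L\<^esub> r}"
  have D: "(ideal_char D :: _ \<Rightarrow> 't set) \<in> join_hom L two"
    using p by (intro ideal_char_join_hom) (auto simp: D_def L.join_le_iff)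
  have E: "(ideal_char E :: _ \<Rightarrow> 't set) \<in> join_hom L two"
  proof (rule ideal_char_join_hom)
    fix x y assume xy: "x \<in> carrier L" "y \<in> carrier L"
    show "x \<squnion>\<^bsub>L\<^esub> y \<in> E \<longleftrightarrow> x \<in> E \<and> y \<in> E"
    proof
      assume "x \<squnion>\<^bsub>L\<^esub> y \<in> E"
      then show "x \<in> E \<and> y \<in> E"
        using xy R_closed by (auto simp: E_def L.join_le_iff subset_iff)
    next
      assume "x \<in> E \<and> y \<in> E"
      then obtain r s where rs: "r \<in> R" "s \<in> R" "r \<sqsubseteq>\<^bsub>L\<^esub> p" "s \<sqsubseteq>\<^bsub>L\<^esub> p" "x \<sqsubseteq>\<^bsub>L\<^esub> r" "y \<sqsubseteq>\<^bsub>L\<^esub> s"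
        by (auto simp: E_def)
      have rsL: "r \<in> carrier L" "s \<in> carrier L" using rs R_closed by auto
      have "r \<squnion>\<^bsub>L\<^esub> s \<sqsubseteq>\<^bsub>L\<^esub> p" using rs rsL p by (simp add: L.join_le)
      moreover have "x \<squnion>\<^bsub>L\<^esub> y \<sqsubseteq>\<^bsub>L\<^esub> r \<squnion>\<^bsub>L\<^esub> s"
        using rs rsL xy by (simp add: L.join_mono)
      ultimately show "x \<squnion>\<^bsub>L\<^esub> y \<in> E" using R_join rs xy by (auto simp: E_def)
    qed
  qed
  \<comment> \<open>An element of the image below \<open>p\<close> is its own witness for membership
    in \<open>E\<close>; the converse is transitivity.\<close>
  have agree: "r \<in> D \<longleftrightarrow> r \<in> E" if "r \<in> R" for r
    using that R_closed p by (auto simp: D_def E_def intro: L.le_trans)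
  have agree_stage: "\<phi> \<alpha> x \<in> D \<longleftrightarrow> \<phi> \<alpha> x \<in> E" if "x \<in> carrier (S \<alpha>)" for \<alpha> x
    using that by (intro agree) (auto simp: R_def)
  have pD: "p \<in> D" using p by (simp add: D_def)
  have pE: "p \<notin> E"
  proof
    assume "p \<in> E"
    then obtain r where "r \<in> R" "r \<sqsubseteq>\<^bsub>L\<^esub> p" "p \<sqsubseteq>\<^bsub>L\<^esub> r" by (auto simp: E_def)
    then have "p \<in> R" using R_closed p L.le_antisym[of p r] by auto
    then show False using not_image by (auto simp: R_def)
  qed
  let ?g = "\<lambda>\<alpha> x. ideal_char D (\<phi> \<alpha> x) :: 't set"
  let ?hD = "restrict (ideal_char D) (carrier L) :: _ \<Rightarrow> 't set"
  let ?hE = "restrict (ideal_char E) (carrier L) :: _ \<Rightarrow> 't set"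
  have "?g \<alpha> \<in> join_hom (S \<alpha>) two" for \<alpha>
  proof -
    have "?g \<alpha> x \<in> carrier two" if "x \<in> carrier (S \<alpha>)" for x
      using that by (intro join_hom_closed[OF D] join_hom_closed[OF hom])
    moreover have "?g \<alpha> (x \<squnion>\<^bsub>S \<alpha>\<^esub> y) = ?g \<alpha> x \<squnion>\<^bsub>two\<^esub> ?g \<alpha> y"
      if "x \<in> carrier (S \<alpha>)" "y \<in> carrier (S \<alpha>)" for x y
      using that by (simp only: join_hom_join[OF hom] join_hom_join[OF D] join_hom_closed[OF hom])
    ultimately show ?thesis by (simp add: join_hom_def)
  qed
  then have "join_cocone S f two ?g"
    by (auto simp: join_cocone_def upper_semilattice_two f_\<phi>)
  then have "\<exists>!h. h \<in> join_hom L (two :: 't set gorder) \<and> h \<in> extensional (carrier L) \<and>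
              (\<forall>\<alpha>. \<forall>x\<in>carrier (S \<alpha>). h (\<phi> \<alpha> x) = ?g \<alpha> x)"
    using limit by (simp add: join_direct_limit_def)
  moreover have "?hD \<in> join_hom L two \<and> ?hD \<in> extensional (carrier L) \<and>
              (\<forall>\<alpha>. \<forall>x\<in>carrier (S \<alpha>). ?hD (\<phi> \<alpha> x) = ?g \<alpha> x)"
    using restrict_join_hom[OF L.upper_semilattice_axioms D] join_hom_closed[OF hom] by auto
  moreover have "?hE \<in> join_hom L two \<and> ?hE \<in> extensional (carrier L) \<and>
              (\<forall>\<alpha>. \<forall>x\<in>carrier (S \<alpha>). ?hE (\<phi> \<alpha> x) = ?g \<alpha> x)"
    using restrict_join_hom[OF L.upper_semilattice_axioms E] join_hom_closed[OF hom] agree_stage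
    by (simp add: ideal_char_def)
  ultimately have "?hD = ?hE" by blast
  then have "?hD p = ?hE p" by simp
  then show False using p pD pE by (auto simp: ideal_char_def)
qed

text \<open>This rests on the existence of mediating maps, for a cocone into \<open>two\<close> that
  detects whether an element eventually falls below the image of \<open>x\<close>. Monotonicity of
  the mediating map transfers the inequality of the limit to this cocone.\<close>

lemma join_limit_le_imp_stage_le:
  fixes S :: "'i::linorder \<Rightarrow> 'a gorder" and f L \<phi> \<alpha> \<beta> x y
  assumes system: "join_direct_system S f"
    and limit: "join_direct_limit TYPE('t set) S f L \<phi>"
    and x: "x \<in> carrier (S \<alpha>)" and y: "y \<in> carrier (S \<beta>)"
    and le: "\<phi> \<beta> y \<sqsubseteq>\<^bsub>L\<^esub> \<phi> \<alpha> x"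
  shows "\<exists>\<gamma>. \<alpha> \<le> \<gamma> \<and> \<beta> \<le> \<gamma> \<and> f \<beta> \<gamma> y \<sqsubseteq>\<^bsub>S \<gamma>\<^esub> f \<alpha> \<gamma> x"
proof -
  have cocone: "join_cocone S f L \<phi>" using limit by (simp add: join_direct_limit_def)
  have hom: "\<phi> \<alpha> \<in> join_hom (S \<alpha>) L" for \<alpha> using cocone by (simp add: join_cocone_def)
  interpret L: upper_semilattice L using cocone by (simp add: join_cocone_def)
  interpret S: upper_semilattice "S \<xi>" for \<xi> using system by (simp add: join_direct_system_def)
  have f_hom: "f \<alpha> \<beta> \<in> join_hom (S \<alpha>) (S \<beta>)" if "\<alpha> \<le> \<beta>" for \<alpha> \<beta>
    using system that by (simp add: join_direct_system_def)
  have f_comp: "f \<beta> \<gamma> (f \<alpha> \<beta> x) = f \<alpha> \<gamma> x"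
    if "\<alpha> \<le> \<beta>" "\<beta> \<le> \<gamma>" "x \<in> carrier (S \<alpha>)" for \<alpha> \<beta> \<gamma> x
    using system that by (simp add: join_direct_system_def)
  \<comment> \<open>This is the expected trace on \<open>S \<beta>\<close> of the principal ideal of
    \<open>\<phi> \<alpha> x\<close>, written without reference to \<open>L\<close>.\<close>
  define D where "D \<beta> = {y \<in> carrier (S \<beta>). \<exists>\<gamma>. \<alpha> \<le> \<gamma> \<and> \<beta> \<le> \<gamma> \<and> f \<beta> \<gamma> y \<sqsubseteq>\<^bsub>S \<gamma>\<^esub> f \<alpha> \<gamma> x}" for \<beta>
  \<comment> \<open>Once reached, the inequality persists, because transition maps are monotone.
    Witnessing stages can therefore be replaced by their maximum.\<close>
  have later: "f \<beta> \<delta> y \<sqsubseteq>\<^bsub>S \<delta>\<^esub> f \<alpha> \<delta> x"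
    if "\<alpha> \<le> \<gamma>" "\<beta> \<le> \<gamma>" "f \<beta> \<gamma> y \<sqsubseteq>\<^bsub>S \<gamma>\<^esub> f \<alpha> \<gamma> x" "\<gamma> \<le> \<delta>" "y \<in> carrier (S \<beta>)" for \<beta> \<gamma> \<delta> y
  proof -
    have "f \<gamma> \<delta> (f \<beta> \<gamma> y) \<sqsubseteq>\<^bsub>S \<delta>\<^esub> f \<gamma> \<delta> (f \<alpha> \<gamma> x)"
      using that join_hom_closed[OF f_hom[OF that(1)] x] join_hom_closed[OF f_hom[OF that(2)]]
      by (intro join_hom_mono[OF S.upper_semilattice_axioms S.upper_semilattice_axioms f_hom]) auto
    then show ?thesis using that x by (simp add: f_comp)
  qed
  let ?g = "\<lambda>\<beta>. ideal_char (D \<beta>) :: 'a \<Rightarrow> 't set"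
  have "?g \<beta> \<in> join_hom (S \<beta>) two" for \<beta>
  proof (rule ideal_char_join_hom)
    fix u v assume uv: "u \<in> carrier (S \<beta>)" "v \<in> carrier (S \<beta>)"
    have split: "f \<beta> \<gamma> (u \<squnion>\<^bsub>S \<beta>\<^esub> v) \<sqsubseteq>\<^bsub>S \<gamma>\<^esub> f \<alpha> \<gamma> x
        \<longleftrightarrow> f \<beta> \<gamma> u \<sqsubseteq>\<^bsub>S \<gamma>\<^esub> f \<alpha> \<gamma> x \<and> f \<beta> \<gamma> v \<sqsubseteq>\<^bsub>S \<gamma>\<^esub> f \<alpha> \<gamma> x"
      if "\<alpha> \<le> \<gamma>" "\<beta> \<le> \<gamma>" for \<gamma>
      using that uv x join_hom_closed[OF f_hom]
      by (simp add: join_hom_join[OF f_hom] S.join_le_iff)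
    show "u \<squnion>\<^bsub>S \<beta>\<^esub> v \<in> D \<beta> \<longleftrightarrow> u \<in> D \<beta> \<and> v \<in> D \<beta>"
    proof
      assume "u \<squnion>\<^bsub>S \<beta>\<^esub> v \<in> D \<beta>"
      then show "u \<in> D \<beta> \<and> v \<in> D \<beta>" using uv split by (auto simp: D_def)
    next
      assume "u \<in> D \<beta> \<and> v \<in> D \<beta>"
      then obtain \<gamma> \<delta> where \<gamma>: "\<alpha> \<le> \<gamma>" "\<beta> \<le> \<gamma>" "f \<beta> \<gamma> u \<sqsubseteq>\<^bsub>S \<gamma>\<^esub> f \<alpha> \<gamma> x"
        and \<delta>: "\<alpha> \<le> \<delta>" "\<beta> \<le> \<delta>" "f \<beta> \<delta> v \<sqsubseteq>\<^bsub>S \<delta>\<^esub> f \<alpha> \<delta> x"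
        by (auto simp: D_def)
      have "f \<beta> (max \<gamma> \<delta>) (u \<squnion>\<^bsub>S \<beta>\<^esub> v) \<sqsubseteq>\<^bsub>S (max \<gamma> \<delta>)\<^esub> f \<alpha> (max \<gamma> \<delta>) x"
        using later[OF \<gamma>, of "max \<gamma> \<delta>"] later[OF \<delta>, of "max \<gamma> \<delta>"] uv \<gamma> \<delta>
        by (subst split) (auto simp: le_max_iff_disj)
      moreover have "\<alpha> \<le> max \<gamma> \<delta>" "\<beta> \<le> max \<gamma> \<delta>" using \<gamma> by (auto simp: le_max_iff_disj)
      ultimately show "u \<squnion>\<^bsub>S \<beta>\<^esub> v \<in> D \<beta>" using uv by (auto simp: D_def)
    qed
  qed
  moreover have "?g \<delta> (f \<beta> \<delta> u) = ?g \<beta> u" if "\<beta> \<le> \<delta>" "u \<in> carrier (S \<beta>)" for \<beta> \<delta> u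
  proof -
    have "f \<beta> \<delta> u \<in> D \<delta>" if uD: "u \<in> D \<beta>"
    proof -
      obtain \<gamma> where \<gamma>: "\<alpha> \<le> \<gamma>" "\<beta> \<le> \<gamma>" "f \<beta> \<gamma> u \<sqsubseteq>\<^bsub>S \<gamma>\<^esub> f \<alpha> \<gamma> x"
        using uD by (auto simp: D_def)
      then have "f \<delta> (max \<gamma> \<delta>) (f \<beta> \<delta> u) \<sqsubseteq>\<^bsub>S (max \<gamma> \<delta>)\<^esub> f \<alpha> (max \<gamma> \<delta>) x"
        using later[OF \<gamma>, of "max \<gamma> \<delta>"] \<open>\<beta> \<le> \<delta>\<close> \<open>u \<in> carrier (S \<beta>)\<close> by (simp add: f_comp)
      moreover have "\<alpha> \<le> max \<gamma> \<delta>" using \<gamma> by (auto simp: le_max_iff_disj)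
      ultimately show ?thesis
        using \<open>\<beta> \<le> \<delta>\<close> \<open>u \<in> carrier (S \<beta>)\<close> join_hom_closed[OF f_hom]
        by (auto simp: D_def intro!: exI[of _ "max \<gamma> \<delta>"])
    qed
    moreover have "u \<in> D \<beta>" if "f \<beta> \<delta> u \<in> D \<delta>"
      using that \<open>\<beta> \<le> \<delta>\<close> \<open>u \<in> carrier (S \<beta>)\<close> by (auto simp: D_def f_comp intro: order_trans)
    ultimately show ?thesis by (auto simp: ideal_char_def)
  qed
  ultimately have "join_cocone S f two ?g"
    by (auto simp: join_cocone_def upper_semilattice_two)
  then obtain h where h: "h \<in> join_hom L (two :: 't set gorder)"
    "\<And>\<beta> y. y \<in> carrier (S \<beta>) \<Longrightarrow> h (\<phi> \<beta> y) = ?g \<beta> y"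
    using limit unfolding join_direct_limit_def by blast
  have "h (\<phi> \<beta> y) \<subseteq> h (\<phi> \<alpha> x)"
    using join_hom_mono[OF L.upper_semilattice_axioms upper_semilattice_two h(1) _ _ le]
      join_hom_closed[OF hom] x y by simp
  \<comment> \<open>Stage \<open>\<alpha>\<close> itself is a witness, so \<open>h\<close> sends
    \<open>\<phi> \<alpha> x\<close> to the empty set. The inclusion then forces the same value at
    \<open>\<phi> \<beta> y\<close>, which means \<open>y \<in> D \<beta>\<close>.\<close>
  moreover have "x \<in> D \<alpha>"
    using x join_hom_closed[OF f_hom] by (auto simp: D_def intro!: exI[of _ \<alpha>])
  ultimately have "y \<in> D \<beta>"
    using x y by (auto simp: h ideal_char_def split: if_splits)
  then show ?thesis by (simp add: D_def)
qed

section \<open>The uniform refinement property\<close>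

theorem proposition2p11:
  fixes S :: "'i::linorder \<Rightarrow> 'a gorder"
    and f :: "'i \<Rightarrow> 'i \<Rightarrow> 'a \<Rightarrow> 'a"
    and L :: "'s gorder"
    and \<phi> :: "'i \<Rightarrow> 'a \<Rightarrow> 's"
  assumes "\<And>\<alpha>. distributive_lattice (S \<alpha>)"
    and "join_direct_system S f"
    and "join_direct_limit TYPE(('i \<times> 'a) set) S f L \<phi>"
  shows "URP_plus TYPE('k) L"
proof -
  note system = assms(2) and limit = assms(3)
  have cocone: "join_cocone S f L \<phi>" using limit by (simp add: join_direct_limit_def)
  have hom: "\<phi> \<alpha> \<in> join_hom (S \<alpha>) L" for \<alpha> using cocone by (simp add: join_cocone_def)
  interpret L: upper_semilattice L using cocone by (simp add: join_cocone_def)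
  interpret S: distributive_lattice "S \<xi>" for \<xi> by (rule assms(1))
  have f_hom: "f \<alpha> \<beta> \<in> join_hom (S \<alpha>) (S \<beta>)" if "\<alpha> \<le> \<beta>" for \<alpha> \<beta>
    using system that by (simp add: join_direct_system_def)
  have f_id: "f \<alpha> \<alpha> x = x" if "x \<in> carrier (S \<alpha>)" for \<alpha> x
    using system that by (simp add: join_direct_system_def)
  have f_comp: "f \<beta> \<gamma> (f \<alpha> \<beta> x) = f \<alpha> \<gamma> x"
    if "\<alpha> \<le> \<beta>" "\<beta> \<le> \<gamma>" "x \<in> carrier (S \<alpha>)" for \<alpha> \<beta> \<gamma> x
    using system that by (simp add: join_direct_system_def)
  have f_\<phi>: "\<phi> \<beta> (f \<alpha> \<beta> x) = \<phi> \<alpha> x" if "\<alpha> \<le> \<beta>" "x \<in> carrier (S \<alpha>)" for \<alpha> \<beta> x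
    using cocone that by (simp add: join_cocone_def)
  note f_closed = join_hom_closed[OF f_hom] and \<phi>_closed = join_hom_closed[OF hom]
  note f_join = join_hom_join[OF f_hom] and \<phi>_join = join_hom_join[OF hom]
  note f_mono = join_hom_mono[OF S.upper_semilattice_axioms S.upper_semilattice_axioms f_hom]
  note \<phi>_mono = join_hom_mono[OF S.upper_semilattice_axioms L.upper_semilattice_axioms hom]
  \<comment> \<open>The two inequalities may appear at different stages; both are moved to a common
    later one, where antisymmetry applies.\<close>
  have eq_stage: "\<exists>\<gamma>\<ge>\<delta>. \<alpha> \<le> \<gamma> \<and> \<beta> \<le> \<gamma> \<and> f \<alpha> \<gamma> x = f \<beta> \<gamma> y"
    if xy: "x \<in> carrier (S \<alpha>)" "y \<in> carrier (S \<beta>)" and eq: "\<phi> \<alpha> x = \<phi> \<beta> y" for \<alpha> \<beta> x y \<delta>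
  proof -
    obtain \<gamma> where \<gamma>: "\<alpha> \<le> \<gamma>" "\<beta> \<le> \<gamma>" "f \<beta> \<gamma> y \<sqsubseteq>\<^bsub>S \<gamma>\<^esub> f \<alpha> \<gamma> x"
      using join_limit_le_imp_stage_le[OF system limit xy] xy eq by (auto simp: \<phi>_closed)
    obtain \<gamma>' where \<gamma>': "\<alpha> \<le> \<gamma>'" "\<beta> \<le> \<gamma>'" "f \<alpha> \<gamma>' x \<sqsubseteq>\<^bsub>S \<gamma>'\<^esub> f \<beta> \<gamma>' y"
      using join_limit_le_imp_stage_le[OF system limit xy(2,1)] xy eq by (auto simp: \<phi>_closed)
    define \<epsilon> where "\<epsilon> = max \<delta> (max \<gamma> \<gamma>')"
    have \<epsilon>: "\<delta> \<le> \<epsilon>" "\<gamma> \<le> \<epsilon>" "\<gamma>' \<le> \<epsilon>" by (auto simp: \<epsilon>_def le_max_iff_disj)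
    have \<alpha>\<beta>: "\<alpha> \<le> \<epsilon>" "\<beta> \<le> \<epsilon>" using \<gamma> \<epsilon> by auto
    have "f \<beta> \<epsilon> y \<sqsubseteq>\<^bsub>S \<epsilon>\<^esub> f \<alpha> \<epsilon> x"
      using f_mono[OF \<epsilon>(2) _ _ \<gamma>(3)] \<gamma> \<epsilon> xy by (simp add: f_comp f_closed)
    moreover have "f \<alpha> \<epsilon> x \<sqsubseteq>\<^bsub>S \<epsilon>\<^esub> f \<beta> \<epsilon> y"
      using f_mono[OF \<epsilon>(3) _ _ \<gamma>'(3)] \<gamma>' \<epsilon> xy by (simp add: f_comp f_closed)
    ultimately show ?thesis using \<epsilon> \<alpha>\<beta> xy by (auto intro!: exI[of _ \<epsilon>] S.le_antisym f_closed)
  qed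
  have "URP_plus_at TYPE('k) L e" if e: "e \<in> carrier L" for e
    unfolding URP_plus_at_def
  proof (intro allI impI)
    fix I :: "'k set" and a b
    assume ab: "\<forall>i\<in>I. a i \<in> carrier L \<and> b i \<in> carrier L \<and> a i \<squnion>\<^bsub>L\<^esub> b i = e"

    \<comment> \<open>Representatives with a prescribed join\<close>
    obtain \<epsilon> e\<^sub>0 where e\<^sub>0: "e\<^sub>0 \<in> carrier (S \<epsilon>)" "e = \<phi> \<epsilon> e\<^sub>0"
      using join_limit_jointly_surjective[OF system limit e] by auto
    \<comment> \<open>The stage depends on \<open>i\<close>, since an infinite \<open>I\<close> need
      not admit a common one. Prescribing every join as an image of the single
      \<open>e\<^sub>0\<close> makes the joins for different indices agree at each common later
      stage.\<close>
    have "\<forall>i\<in>I. \<exists>\<gamma> x y. \<epsilon> \<le> \<gamma> \<and> x \<in> carrier (S \<gamma>) \<and> y \<in> carrier (S \<gamma>)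
        \<and> \<phi> \<gamma> x = a i \<and> \<phi> \<gamma> y = b i \<and> x \<squnion>\<^bsub>S \<gamma>\<^esub> y = f \<epsilon> \<gamma> e\<^sub>0"
    proof
      fix i assume i: "i \<in> I"
      obtain \<alpha> x where x: "x \<in> carrier (S \<alpha>)" "a i = \<phi> \<alpha> x"
        using join_limit_jointly_surjective[OF system limit, of "a i"] ab i by auto
      obtain \<beta> y where y: "y \<in> carrier (S \<beta>)" "b i = \<phi> \<beta> y"
        using join_limit_jointly_surjective[OF system limit, of "b i"] ab i by auto
      define \<delta> where "\<delta> = max \<alpha> \<beta>"
      have \<delta>: "\<alpha> \<le> \<delta>" "\<beta> \<le> \<delta>" by (auto simp: \<delta>_def)
      define x' where "x' = f \<alpha> \<delta> x"
      define y' where "y' = f \<beta> \<delta> y"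
      have x': "x' \<in> carrier (S \<delta>)" "\<phi> \<delta> x' = a i" using x \<delta> f_closed by (auto simp: x'_def f_\<phi>)
      have y': "y' \<in> carrier (S \<delta>)" "\<phi> \<delta> y' = b i" using y \<delta> f_closed by (auto simp: y'_def f_\<phi>)
      \<comment> \<open>So far the join is correct only in the limit; \<open>eq_stage\<close>
        provides a stage where it is correct for the representatives themselves.\<close>
      have "\<phi> \<delta> (x' \<squnion>\<^bsub>S \<delta>\<^esub> y') = \<phi> \<epsilon> e\<^sub>0"
        using x' y' ab i e\<^sub>0 by (simp add: \<phi>_join)
      then obtain \<gamma> where \<gamma>: "\<delta> \<le> \<gamma>" "\<epsilon> \<le> \<gamma>" "f \<delta> \<gamma> (x' \<squnion>\<^bsub>S \<delta>\<^esub> y') = f \<epsilon> \<gamma> e\<^sub>0"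
        using eq_stage[of "x' \<squnion>\<^bsub>S \<delta>\<^esub> y'" \<delta> e\<^sub>0 \<epsilon> \<delta>] x' y' e\<^sub>0 by auto
      then show "\<exists>\<gamma> x y. \<epsilon> \<le> \<gamma> \<and> x \<in> carrier (S \<gamma>) \<and> y \<in> carrier (S \<gamma>)
        \<and> \<phi> \<gamma> x = a i \<and> \<phi> \<gamma> y = b i \<and> x \<squnion>\<^bsub>S \<gamma>\<^esub> y = f \<epsilon> \<gamma> e\<^sub>0"
        using x' y' f_closed
        by (intro exI[of _ \<gamma>] exI[of _ "f \<delta> \<gamma> x'"] exI[of _ "f \<delta> \<gamma> y'"]) (simp add: f_\<phi> f_join)
    qed
    then obtain \<nu> A B where stage: "\<And>i. i \<in> I \<Longrightarrow> \<epsilon> \<le> \<nu> i \<and> A i \<in> carrier (S (\<nu> i))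
        \<and> B i \<in> carrier (S (\<nu> i)) \<and> \<phi> (\<nu> i) (A i) = a i \<and> \<phi> (\<nu> i) (B i) = b i
        \<and> A i \<squnion>\<^bsub>S (\<nu> i)\<^esub> B i = f \<epsilon> (\<nu> i) e\<^sub>0"
      by metis

    \<comment> \<open>Meets at the first common stage and their later images\<close>
    define X where "X \<gamma> i = f (\<nu> i) \<gamma> (A i)" for \<gamma> i
    define Y where "Y \<gamma> i = f (\<nu> i) \<gamma> (B i)" for \<gamma> i
    define \<mu> where "\<mu> i j = max (\<nu> i) (\<nu> j)" for i j
    define C where "C i j = X (\<mu> i j) i \<sqinter>\<^bsub>S (\<mu> i j)\<^esub> Y (\<mu> i j) j" for i j
    define c where "c i j = \<phi> (\<mu> i j) (C i j)" for i j
    \<comment> \<open>This need not be the meet of \<open>X \<gamma> i\<close> and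
      \<open>Y \<gamma> j\<close>, because transition maps preserve only joins. \<open>F_top\<close>
      recovers the meet when \<open>\<gamma>\<close> is the stage at which it was formed.\<close>
    define F where "F \<gamma> i j = f (\<mu> i j) \<gamma> (C i j)" for \<gamma> i j
    have X: "X \<gamma> i \<in> carrier (S \<gamma>)" "Y \<gamma> i \<in> carrier (S \<gamma>)" "\<phi> \<gamma> (X \<gamma> i) = a i" "\<phi> \<gamma> (Y \<gamma> i) = b i"
      if "i \<in> I" "\<nu> i \<le> \<gamma>" for i \<gamma>
      using that stage f_closed by (auto simp: X_def Y_def f_\<phi>)
    have X_lift: "f \<gamma> \<delta> (X \<gamma> i) = X \<delta> i" "f \<gamma> \<delta> (Y \<gamma> i) = Y \<delta> i"
      if "i \<in> I" "\<nu> i \<le> \<gamma>" "\<gamma> \<le> \<delta>" for i \<gamma> \<delta>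
      using that stage by (auto simp: X_def Y_def f_comp)
    have XY: "X \<gamma> i \<squnion>\<^bsub>S \<gamma>\<^esub> Y \<gamma> i = f \<epsilon> \<gamma> e\<^sub>0" if "i \<in> I" "\<nu> i \<le> \<gamma>" for i \<gamma>
      using that stage[OF that(1)] f_join[OF that(2), of "A i" "B i"] e\<^sub>0
      by (simp add: X_def Y_def f_comp)
    have \<mu>: "\<nu> i \<le> \<mu> i j" "\<nu> j \<le> \<mu> i j" for i j by (auto simp: \<mu>_def)
    have C: "C i j \<in> carrier (S (\<mu> i j))" if "i \<in> I" "j \<in> I" for i j
      using that \<mu> by (simp add: C_def X)
    have F: "F \<gamma> i j \<in> carrier (S \<gamma>)" "\<phi> \<gamma> (F \<gamma> i j) = c i j" if "i \<in> I" "j \<in> I" "\<mu> i j \<le> \<gamma>" for i j \<gamma>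
      using that C f_closed by (auto simp: F_def c_def f_\<phi>)
    have F_top: "F \<gamma> i j = X \<gamma> i \<sqinter>\<^bsub>S \<gamma>\<^esub> Y \<gamma> j" if "i \<in> I" "j \<in> I" "\<mu> i j = \<gamma>" for i j \<gamma>
      using that C by (auto simp: F_def f_id C_def)
    have F_le: "F \<gamma> i j \<sqsubseteq>\<^bsub>S \<gamma>\<^esub> X \<gamma> i" "F \<gamma> i j \<sqsubseteq>\<^bsub>S \<gamma>\<^esub> Y \<gamma> j"
      if "i \<in> I" "j \<in> I" "\<mu> i j \<le> \<gamma>" for i j \<gamma>
    proof -
      have "C i j \<sqsubseteq>\<^bsub>S (\<mu> i j)\<^esub> X (\<mu> i j) i" "C i j \<sqsubseteq>\<^bsub>S (\<mu> i j)\<^esub> Y (\<mu> i j) j"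
        using that \<mu> X by (auto simp: C_def S.meet_left S.meet_right)
      then show "F \<gamma> i j \<sqsubseteq>\<^bsub>S \<gamma>\<^esub> X \<gamma> i" "F \<gamma> i j \<sqsubseteq>\<^bsub>S \<gamma>\<^esub> Y \<gamma> j"
        using f_mono[OF that(3) C[OF that(1,2)]] that \<mu>
        by (metis F_def X(1) X_lift(1), metis F_def X(2) X_lift(2))
    qed
    have X_le: "X \<gamma> i \<sqsubseteq>\<^bsub>S \<gamma>\<^esub> X \<gamma> j \<squnion>\<^bsub>S \<gamma>\<^esub> F \<gamma> i j"
      and Y_le: "Y \<gamma> j \<sqsubseteq>\<^bsub>S \<gamma>\<^esub> Y \<gamma> i \<squnion>\<^bsub>S \<gamma>\<^esub> F \<gamma> i j"
      if "i \<in> I" "j \<in> I" "\<mu> i j \<le> \<gamma>" for i j \<gamma>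
    proof -
      let ?\<mu> = "\<mu> i j"
      have closed: "X ?\<mu> i \<in> carrier (S ?\<mu>)" "Y ?\<mu> i \<in> carrier (S ?\<mu>)"
        "X ?\<mu> j \<in> carrier (S ?\<mu>)" "Y ?\<mu> j \<in> carrier (S ?\<mu>)"
        using that \<mu> X by auto
      have same: "X ?\<mu> i \<squnion>\<^bsub>S ?\<mu>\<^esub> Y ?\<mu> i = X ?\<mu> j \<squnion>\<^bsub>S ?\<mu>\<^esub> Y ?\<mu> j"
        using that \<mu> XY by simp
      \<comment> \<open>The left side lies below the common join \<open>same\<close>, so
        \<open>le_join_meet\<close> applies. Apart from \<open>C i j\<close>, the right side
        involves only a join, so transition maps carry the inequality to every later stage.\<close>
      have "X ?\<mu> i \<sqsubseteq>\<^bsub>S ?\<mu>\<^esub> X ?\<mu> j \<squnion>\<^bsub>S ?\<mu>\<^esub> C i j"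
        unfolding C_def using closed same S.join_left[of "X ?\<mu> i" ?\<mu> "Y ?\<mu> i"]
        by (intro S.le_join_meet) auto
      from f_mono[OF that(3) _ _ this]
      show "X \<gamma> i \<sqsubseteq>\<^bsub>S \<gamma>\<^esub> X \<gamma> j \<squnion>\<^bsub>S \<gamma>\<^esub> F \<gamma> i j"
        using that closed C \<mu> by (simp add: f_join X_lift F_def)
      have "Y ?\<mu> j \<sqsubseteq>\<^bsub>S ?\<mu>\<^esub> Y ?\<mu> i \<squnion>\<^bsub>S ?\<mu>\<^esub> (Y ?\<mu> j \<sqinter>\<^bsub>S ?\<mu>\<^esub> X ?\<mu> i)"
        using closed same S.join_right[of "X ?\<mu> j" ?\<mu> "Y ?\<mu> j"]
        by (intro S.le_join_meet) (auto simp: join_comm[of _ "Y ?\<mu> i"])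
      then have "Y ?\<mu> j \<sqsubseteq>\<^bsub>S ?\<mu>\<^esub> Y ?\<mu> i \<squnion>\<^bsub>S ?\<mu>\<^esub> C i j"
        by (simp add: C_def meet_comm[of _ "Y ?\<mu> j"])
      from f_mono[OF that(3) _ _ this]
      show "Y \<gamma> j \<sqsubseteq>\<^bsub>S \<gamma>\<^esub> Y \<gamma> i \<squnion>\<^bsub>S \<gamma>\<^esub> F \<gamma> i j"
        using that closed C \<mu> by (simp add: f_join X_lift F_def)
    qed
    have F_triangle: "F \<gamma> i k \<sqsubseteq>\<^bsub>S \<gamma>\<^esub> F \<gamma> i j \<squnion>\<^bsub>S \<gamma>\<^esub> F \<gamma> j k"
      if I: "i \<in> I" "j \<in> I" "k \<in> I" and \<gamma>: "\<gamma> = max (\<nu> i) (max (\<nu> j) (\<nu> k))" for i j k \<gamma>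
    proof -
      have le: "\<nu> i \<le> \<gamma>" "\<nu> j \<le> \<gamma>" "\<nu> k \<le> \<gamma>" "\<mu> i k \<le> \<gamma>" "\<mu> i j \<le> \<gamma>" "\<mu> j k \<le> \<gamma>"
        using \<gamma> by (auto simp: \<mu>_def le_max_iff_disj)
      note closed = X[OF I(1) le(1)] X[OF I(2) le(2)] X[OF I(3) le(3)]
        F(1)[OF I(1,3) le(4)] F(1)[OF I(1,2) le(5)] F(1)[OF I(2,3) le(6)]
      \<comment> \<open>The index with the largest stage decides which of the three terms are meets
        at \<open>\<gamma>\<close>. In the first and third cases the remaining term is on the right
        and enters through \<open>Y_le\<close> or \<open>X_le\<close>.\<close>
      consider "\<nu> i = \<gamma>" | "\<nu> j = \<gamma>" | "\<nu> k = \<gamma>" using \<gamma> by (auto simp: max_def split: if_splits)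
      then show ?thesis
      proof cases
        case 1
        then have "\<mu> i k = \<gamma>" "\<mu> i j = \<gamma>" using le by (auto simp: \<mu>_def)
        then show ?thesis
          using S.meet_join_le[OF _ _ _ _ Y_le[OF I(2,3) le(6)], of "X \<gamma> i"] closed I
          by (simp add: F_top)
      next
        case 2
        then have top: "F \<gamma> i j = X \<gamma> i \<sqinter>\<^bsub>S \<gamma>\<^esub> Y \<gamma> j" "F \<gamma> j k = X \<gamma> j \<sqinter>\<^bsub>S \<gamma>\<^esub> Y \<gamma> k"
          using le I by (auto simp: \<mu>_def intro!: F_top)
        \<comment> \<open>Here the term on the left may come from an earlier stage. It need only be
          bounded from above, and \<open>F_le\<close> bounds it by the meet at
          \<open>\<gamma>\<close>.\<close>
        have "F \<gamma> i k \<sqsubseteq>\<^bsub>S \<gamma>\<^esub> Y \<gamma> k \<sqinter>\<^bsub>S \<gamma>\<^esub> X \<gamma> i"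
          using F_le[OF I(1,3) le(4)] closed by (simp add: S.meet_le)
        also have "Y \<gamma> k \<sqinter>\<^bsub>S \<gamma>\<^esub> X \<gamma> i \<sqsubseteq>\<^bsub>S \<gamma>\<^esub> (Y \<gamma> k \<sqinter>\<^bsub>S \<gamma>\<^esub> X \<gamma> j) \<squnion>\<^bsub>S \<gamma>\<^esub> F \<gamma> i j"
          using X_le[OF I(1,2) le(5)] closed by (intro S.meet_join_le) auto
        finally show ?thesis
          using closed by (simp add: top(2) join_comm[of _ "F \<gamma> i j"] meet_comm[of _ "Y \<gamma> k"])
      next
        case 3
        then have "\<mu> i k = \<gamma>" "\<mu> j k = \<gamma>" using le by (auto simp: \<mu>_def)
        then show ?thesis
          using S.meet_join_le[OF _ _ _ _ X_le[OF I(1,2) le(5)], of "Y \<gamma> k"] closed I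
          by (simp add: F_top join_comm[of _ "F \<gamma> i j"] meet_comm[of _ "Y \<gamma> k"])
      qed
    qed

    \<comment> \<open>Passage to the limit\<close>
    have c_closed: "c i j \<in> carrier L" if "i \<in> I" "j \<in> I" for i j
      using that C \<phi>_closed by (simp add: c_def)
    \<comment> \<open>Since \<open>F \<gamma> i j\<close> represents \<open>c i j\<close> at every
      stage from \<open>\<mu> i j\<close> on, each inequality is transferred from a convenient
      stage: \<open>\<mu> i j\<close> for (i) and (ii), the largest of the three stages for
      (iii).\<close>
    have c_le: "c i j \<sqsubseteq>\<^bsub>L\<^esub> a i" "c i j \<sqsubseteq>\<^bsub>L\<^esub> b j" if "i \<in> I" "j \<in> I" for i j
      using \<phi>_mono[OF _ _ F_le(1)[OF that order_refl]] \<phi>_mono[OF _ _ F_le(2)[OF that order_refl]]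
        that \<mu> X F by auto
    have a_le: "a i \<sqsubseteq>\<^bsub>L\<^esub> a j \<squnion>\<^bsub>L\<^esub> c i j" and b_le: "b j \<sqsubseteq>\<^bsub>L\<^esub> b i \<squnion>\<^bsub>L\<^esub> c i j"
      if "i \<in> I" "j \<in> I" for i j
      using \<phi>_mono[OF _ _ X_le[OF that order_refl]] \<phi>_mono[OF _ _ Y_le[OF that order_refl]]
        that \<mu> X F by (auto simp: \<phi>_join)
    have c_triangle: "c i k \<sqsubseteq>\<^bsub>L\<^esub> c i j \<squnion>\<^bsub>L\<^esub> c j k" if "i \<in> I" "j \<in> I" "k \<in> I" for i j k
    proof -
      define \<gamma> where "\<gamma> = max (\<nu> i) (max (\<nu> j) (\<nu> k))"
      have le: "\<mu> i k \<le> \<gamma>" "\<mu> i j \<le> \<gamma>" "\<mu> j k \<le> \<gamma>" by (auto simp: \<mu>_def \<gamma>_def le_max_iff_disj)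
      show ?thesis
        using \<phi>_mono[OF _ _ F_triangle[OF that \<gamma>_def]] F le that by (simp add: \<phi>_join)
    qed
    show "\<exists>c. (\<forall>i\<in>I. \<forall>j\<in>I. c i j \<in> carrier L) \<and>
             (\<forall>i\<in>I. \<forall>j\<in>I. c i j \<sqsubseteq>\<^bsub>L\<^esub> a i \<and> c i j \<sqsubseteq>\<^bsub>L\<^esub> b j) \<and>
             (\<forall>i\<in>I. \<forall>j\<in>I. a i \<sqsubseteq>\<^bsub>L\<^esub> a j \<squnion>\<^bsub>L\<^esub> c i j \<and> b j \<sqsubseteq>\<^bsub>L\<^esub> b i \<squnion>\<^bsub>L\<^esub> c i j) \<and>
             (\<forall>i\<in>I. \<forall>j\<in>I. \<forall>k\<in>I. c i k \<sqsubseteq>\<^bsub>L\<^esub> c i j \<squnion>\<^bsub>L\<^esub> c j k)"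
      using c_closed c_le a_le b_le c_triangle
      by (intro exI[of _ c] conjI ballI) simp_all
  qed
  then show ?thesis by (simp add: URP_plus_def)
qed

end
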